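(* For integers $k\ge 1$ and $0\le i\le \min(10,k)$, let $\Gamma_i(k)$ denote the number of quintuple persymmetric $10\times k$ matrices over $\mathbb{F}_2$ (as defined in the context) of rank $i$ over $\mathbb{F}_2$. Then: \begin{itemize} \item $\Gamma_0(k)=1$ for $k\ge 1$; \item $\Gamma_1(k)=93$ for $k\ge 2$; \item $\Gamma_2(k)=31\cdot 2^{k+1}+6386$ for $k\ge 3$; \item $\Gamma_3(k)=6510\cdot 2^{k}+364560$ for $k\ge 4$; \item $\Gamma_4(k)=620\cdot 2^{2k}+448260\cdot 2^{k}+15748000$ for $k\ge 5$; \item $\Gamma_5(k)=65100\cdot 2^{2k}+22654800\cdot 2^{k}+250817280$ for $k\ge 6$; \item $\Gamma_6(k)=1240\cdot\big[2^{3k}+3199\cdot 2^{2k}+2^{7}\cdot 3913\cdot 2^{k}-18883\cdot 2^{10}\big]$ for $k\ge 7$; \item $\Gamma_7(k)=115320\cdot\big[2^{3k}+1148\cdot 2^{2k}-2^{7}\cdot 917\cdot 2^{k}+311\cdot 2^{13}\big]$ for $k\ge 8$; \item $\Gamma_8(k)=496\cdot\big[2^{4k}+9525\cdot 2^{3k}-2169440\cdot 2^{2k}+68115\cdot 2^{11}\cdot 2^{k}-9749\cdot 2^{18}\big]$ for $k\ge 9$; \item $\Gamma_9(k)=31248\cdot\big[2^{4k}-480\cdot 2^{3k}+71680\cdot 2^{2k}-3932160\cdot 2^{k}+2^{26}\big]$ for $k\ge 10$; \item $\Gamma_{10}(k)=2^{5}\cdot\big[2^{5k}-992\cdot 2^{4k}+317440\cdot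 2^{3k}-40632320\cdot 2^{2k}+2080374784\cdot 2^{k}-2^{35}\big]$ for $k\ge 10$. \end{itemize}
   Context: Fix an integer $k\ge 1$. A quintuple persymmetric $10\times k$ matrix over $\mathbb{F}_2$ is determined by a tuple $(\alpha^{(l)}_j)_{1\le l\le 5,\ 1\le j\le k+1}\in\mathbb{F}_2^{5(k+1)}$: it is the $10\times k$ matrix whose row $2l-1$ is $(\alpha^{(l)}_1,\alpha^{(l)}_2,\dots,\alpha^{(l)}_k)$ and whose row $2l$ is $(\alpha^{(l)}_2,\alpha^{(l)}_3,\dots,\alpha^{(l)}_{k+1})$, for $l=1,\dots,5$ (i.e. five stacked $2\times k$ Hankel blocks, the $l$-th built from the sequence $\alpha^{(l)}_1,\dots,\alpha^{(l)}_{k+1}$). The number $\Gamma_i(k)$ counts the tuples in $\mathbb{F}_2^{5(k+1)}$ whose associated matrix has rank exactly $i$ over $\mathbb{F}_2$ (so $\sum_i \Gamma_i(k)=2^{5(k+1)}$). *)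

theory Defs
  imports
    "HOL-Library.Z2"
    "HOL-Library.FuncSet"
    "Jordan_Normal_Form.DL_Rank"
begin

text \<open>
  The field with two elements is \<^typ>\<open>bit\<close>. The entry \<open>\<alpha> (l, j)\<close> is the \<open>j\<close>-th term of the
  \<open>l\<close>-th sequence; both indices start at 1. The functions are extensional, so that they
  correspond bijectively to the tuples in \<open>\<bbbF>\<^sub>2\<close> indexed by \<open>{1..5} \<times> {1..k + 1}\<close>.
\<close>

definition persym_tuples :: "nat \<Rightarrow> (nat \<times> nat \<Rightarrow> bit) set" where
  "persym_tuples k = ({1..5} \<times> {1..k + 1}) \<rightarrow>\<^sub>E UNIV"

text \<open>
  Matrix indices start at 0: for \<open>l = 1, \<dots>, 5\<close>, the rows \<open>2l - 1\<close> and \<open>2l\<close> of the usual 1-based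
  numbering are the rows \<open>r = 2(l - 1)\<close> and \<open>r = 2(l - 1) + 1\<close> here, so that \<open>l = r div 2 + 1\<close>,
  and the entry of row \<open>r\<close> in the 0-based column \<open>c\<close> is the term with index \<open>c + 1 + r mod 2\<close>.
\<close>

definition persym_mat :: "nat \<Rightarrow> (nat \<times> nat \<Rightarrow> bit) \<Rightarrow> bit mat" where
  "persym_mat k \<alpha> = mat 10 k (\<lambda>(r, c). \<alpha> (r div 2 + 1, c + 1 + r mod 2))"

text \<open>The first argument of \<^const>\<open>vec_space.rank\<close> is the number of rows.\<close>

definition persym_count :: "nat \<Rightarrow> nat \<Rightarrow> nat" where
  "persym_count i k =
     card {\<alpha> \<in> persym_tuples k. vec_space.rank 10 (persym_mat k \<alpha>) = i}"

end

theory Submission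
  imports Defs "HOL-Library.Product_Plus" "HOL-Library.Cardinality"
begin

text \<open>
  A tuple is read as a list \<open>a\<^sub>1, \<dots>, a\<^sub>k\<^sub>+\<^sub>1\<close> of vectors of \<open>V = F\<^sub>2\<^sup>5\<close>. The columns of its matrix
  are the consecutive pairs \<open>(a\<^sub>j, a\<^sub>j\<^sub>+\<^sub>1)\<close>, so the rank is the dimension of their span \<open>W\<close> in
  \<open>V \<times> V\<close>. Let the list grow by prepending vectors \<open>x\<close>. The second projection maps \<open>W\<close> onto the
  span \<open>U'\<close> of the tail of the list, hence \<open>(x, a\<^sub>1) \<in> W\<close> holds for \<open>2 ^ (dim W - dim U')\<close> vectors
  \<open>x\<close> if \<open>a\<^sub>1 \<in> U'\<close>, all of them in the span \<open>U\<close> of the list, and for no \<open>x\<close> otherwise. So the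
  numbers of lists with given dimensions of \<open>U\<close>, \<open>U'\<close> and \<open>W\<close> satisfy a linear recursion in \<open>k\<close>. It
  is solved by products of Gaussian binomial coefficients, and summation gives, for \<open>i < k\<close>,
  \<open>\<Gamma>\<^sub>i(k) = (\<Sum>s\<le>i. (\<Prod>j<s. 32 - 2 ^ j) * 2 ^ (d * (d + 1)) * [k - s, d] * [s + 1, d + 1])\<close> with
  \<open>d = i - s\<close>. Over the field with two elements a subspace is the same as a subgroup, so the
  recursion is derived in elementary abelian 2-groups.
\<close>

section \<open>Elementary abelian 2-groups\<close>

class elementary_2_group = ab_group_add +
  assumes add_self [simp]: "x + x = 0"
begin

lemma add_self_left [simp]: "x + (x + y) = y"
  by (simp flip: add.assoc)

end

instance bit :: finite
proof
  have "(UNIV :: bit set) = {0, 1}"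
    by (auto intro: bit.exhaust)
  then show "finite (UNIV :: bit set)"
    by (metis finite.emptyI finite_insert)
qed

instance bit :: elementary_2_group
proof
  show "x + x = 0" for x :: bit
    by (cases x) auto
qed

instance prod :: (elementary_2_group, elementary_2_group) elementary_2_group
  by standard (simp add: zero_prod_def prod_eq_iff)

text \<open>Since \<open>x + x = 0\<close>, a further generator contributes a single coset, so this
  is the subgroup generated by the list, hence its linear span.\<close>

primrec gspan :: "'a::elementary_2_group list \<Rightarrow> 'a set" where
  "gspan [] = {0}"
| "gspan (x # xs) = gspan xs \<union> (+) x ` gspan xs"

text \<open>A vector counts when it lies outside the span of those after it; this direction fits
  lists that grow by prepending.\<close>

primrec gdim :: "'a::elementary_2_group list \<Rightarrow> nat" where
  "gdim [] = 0"
| "gdim (x # xs) = (if x \<in> gspan xs then gdim xs else Suc (gdim xs))"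

lemma zero_in_gspan [simp]: "0 \<in> gspan xs"
  by (induction xs) auto

lemma gspan_add: "x \<in> gspan xs \<Longrightarrow> y \<in> gspan xs \<Longrightarrow> x + y \<in> gspan xs"
proof (induction xs arbitrary: x y)
  case Nil
  then show ?case by simp
next
  case (Cons a xs)
  have 1: "(a + u) + v = a + (u + v)" "u + (a + v) = a + (u + v)" "(a + u) + (a + v) = u + v" for u v
    by (simp_all add: add.assoc add.left_commute)
  show ?case
    using Cons.prems Cons.IH by (auto simp: 1)
qed

lemma gspan_add_iff:
  assumes "x \<in> gspan xs"
  shows "x + y \<in> gspan xs \<longleftrightarrow> y \<in> gspan xs"
  using gspan_add[OF assms, of y] gspan_add[OF assms, of "x + y"] by auto

lemma finite_gspan [simp]: "finite (gspan xs)"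
  by (induction xs) auto

text \<open>The coset added by \<open>x\<close> either lies in the old span or is disjoint from it,
  so the cardinality stays or doubles.\<close>

lemma card_gspan: "card (gspan xs) = 2 ^ gdim xs"
proof (induction xs)
  case (Cons x xs)
  show ?case
  proof (cases "x \<in> gspan xs")
    case True
    then have "(+) x ` gspan xs \<subseteq> gspan xs"
      by (auto intro: gspan_add)
    then have "gspan (x # xs) = gspan xs"
      by auto
    then show ?thesis
      using True Cons by simp
  next
    case False
    have "gspan xs \<inter> (+) x ` gspan xs = {}"
    proof (rule ccontr)
      assume "\<not> ?thesis"
      then obtain y where y: "y \<in> gspan xs" "x + y \<in> gspan xs"
        by blast
      then show False
        using False gspan_add_iff[OF y(1), of x] by (simp add: add.commute)
    qed
    then have "card (gspan (x # xs)) = card (gspan xs) + card ((+) x ` gspan xs)"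
      by (simp add: card_Un_disjoint)
    also have "card ((+) x ` gspan xs) = card (gspan xs)"
      by (intro card_image) (auto simp: inj_on_def)
    finally show ?thesis
      using False Cons by simp
  qed
qed simp

lemma gspan_map:
  fixes f :: "'a::elementary_2_group \<Rightarrow> 'b::elementary_2_group"
  assumes "\<And>x y. f (x + y) = f x + f y"
  shows "gspan (map f xs) = f ` gspan xs"
proof (induction xs)
  case Nil
  show ?case
    using assms[of 0 0] by simp
qed (simp add: assms image_Un image_image)

lemma gspan_butlast_subset: "gspan (butlast xs) \<subseteq> gspan xs"
  by (induction xs) auto

section \<open>Spans of consecutive pairs\<close>

abbreviation cpairs :: "'a list \<Rightarrow> ('a \<times> 'a) list" where
  "cpairs xs \<equiv> zip xs (tl xs)"

lemma cpairs_Cons: "xs \<noteq> [] \<Longrightarrow> zip (x # xs) xs = (x, hd xs) # cpairs xs"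
  by (cases xs) auto

lemma map_fst_cpairs: "map fst (cpairs xs) = butlast xs"
  by (simp add: map_fst_zip_take butlast_conv_take)

lemma map_snd_cpairs: "map snd (cpairs xs) = tl xs"
  by (simp add: map_snd_zip_take)

lemma snd_gspan_cpairs: "snd ` gspan (cpairs xs) = gspan (tl xs)"
  using gspan_map[of snd "cpairs xs"] by (simp add: map_snd_cpairs)

lemma gspan_cpairs_fst: "(x, y) \<in> gspan (cpairs xs) \<Longrightarrow> x \<in> gspan xs"
  using gspan_map[of fst "cpairs xs"] gspan_butlast_subset[of xs]
  by (force simp: map_fst_cpairs)

text \<open>The fibres of the second projection over its image \<open>gspan (tl xs)\<close> are
  translates of one another. The product form avoids a difference of exponents.\<close>

lemma card_fibre_gspan_cpairs:
  fixes xs :: "'a::{elementary_2_group, finite} list"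
  assumes "y \<in> gspan (tl xs)"
  shows "2 ^ gdim (tl xs) * card {x. (x, y) \<in> gspan (cpairs xs)} = 2 ^ gdim (cpairs xs)"
proof -
  let ?W = "gspan (cpairs xs)"
  let ?F = "\<lambda>y. {x. (x, y) \<in> ?W}"
  have fibre: "card (?F z) = card (?F y)" if z: "z \<in> gspan (tl xs)" for z
  proof -
    \<comment> \<open>Translation by an element of the pair span over \<open>y + z\<close> exchanges
      the fibres over \<open>y\<close> and \<open>z\<close>.\<close>
    have "y + z \<in> snd ` ?W"
      using assms z by (simp add: snd_gspan_cpairs gspan_add)
    then obtain u where u: "(u, y + z) \<in> ?W"
      by auto
    have mem: "(u + x, z) \<in> ?W \<longleftrightarrow> (x, y) \<in> ?W" for x
      using gspan_add_iff[OF u, of "(x, y)"] by (simp add: add.commute add.left_commute)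
    have "?F z = (+) u ` ?F y"
    proof (intro equalityI subsetI)
      fix x assume "x \<in> ?F z"
      then have "u + x \<in> ?F y"
        using mem[of "u + x"] by simp
      then show "x \<in> (+) u ` ?F y"
        by (metis add_self_left imageI)
    qed (auto simp: mem)
    then show ?thesis
      by (simp add: card_image inj_on_def)
  qed
  have snd_mem: "v \<in> gspan (tl xs)" if "(u, v) \<in> ?W" for u v
    using that snd_gspan_cpairs[of xs] by force
  have "card ?W = card (SIGMA z : gspan (tl xs). ?F z)"
  proof (rule bij_betw_same_card[of prod.swap])
    show "bij_betw prod.swap ?W (SIGMA z : gspan (tl xs). ?F z)"
      using snd_mem by (intro bij_betw_byWitness[of _ prod.swap]) auto
  qed
  also have "\<dots> = (\<Sum>z\<in>gspan (tl xs). card (?F z))"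
    by simp
  also have "\<dots> = card (gspan (tl xs)) * card (?F y)"
    using fibre by simp
  finally show ?thesis
    by (simp add: card_gspan)
qed

lemma gdim_tl_le: "gdim (tl xs) \<le> gdim (cpairs (xs :: 'a::{elementary_2_group, finite} list))"
proof -
  have "(2::nat) ^ gdim (tl xs) dvd 2 ^ gdim (cpairs xs)"
    using card_fibre_gspan_cpairs[OF zero_in_gspan, of xs] by (metis dvd_triv_left)
  then show ?thesis
    by (simp add: dvd_power_iff_le)
qed

lemma gdim_le_Suc_gdim_tl: "gdim xs \<le> Suc (gdim (tl xs))"
  by (cases xs) auto

section \<open>The transfer recursion\<close>

text \<open>
  The index \<open>e\<close> is shifted by one against the excess of the dimension of the pair span, so that
  \<open>s\<close> and \<open>s + e - 1\<close> are the dimensions of the span of the list and of its consecutive pairs in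
  both definitions, and the growing lists with \<open>e = 0\<close> are the linearly independent ones.
\<close>

definition stationary_lists :: "nat \<Rightarrow> nat \<Rightarrow> nat \<Rightarrow> 'a::elementary_2_group list set" where
  "stationary_lists k s e = {xs. length xs = Suc k \<and> gdim xs = s \<and> gdim (tl xs) = s \<and>
     Suc (gdim (cpairs xs)) = s + e}"

definition growing_lists :: "nat \<Rightarrow> nat \<Rightarrow> nat \<Rightarrow> 'a::elementary_2_group list set" where
  "growing_lists k s e = {xs. length xs = Suc k \<and> gdim xs = s \<and> Suc (gdim (tl xs)) = s \<and>
     Suc (gdim (cpairs xs)) = s + e}"

lemma finite_lists_length: "finite {xs :: 'a::finite list. length xs = n}"
  using finite_lists_length_eq[of "UNIV :: 'a set" n] by simp

lemma card_lists_Suc: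
  fixes Q :: "'a::finite list \<Rightarrow> bool"
  shows "card {xs. length xs = Suc n \<and> Q xs} = (\<Sum>xs | length xs = n. card {x. Q (x # xs)})"
proof -
  have "card {xs. length xs = Suc n \<and> Q xs} = card (SIGMA xs : {xs. length xs = n}. {x. Q (x # xs)})"
  proof (rule bij_betw_same_card[of "\<lambda>xs. (tl xs, hd xs)"])
    show "bij_betw (\<lambda>xs. (tl xs, hd xs)) {xs. length xs = Suc n \<and> Q xs}
        (SIGMA xs : {xs. length xs = n}. {x. Q (x # xs)})"
      by (rule bij_betw_byWitness[of _ "\<lambda>(xs, x). x # xs"]) (auto simp: length_Suc_conv)
  qed
  then show ?thesis
    by (simp add: finite_lists_length)
qed

lemma sum_of_bool_card:
  assumes "finite A" "B \<subseteq> A"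
  shows "(\<Sum>x\<in>A. of_bool (x \<in> B)) = real (card B)"
  using assms by (simp add: sum.If_cases of_bool_def Int_absorb1)

text \<open>The span stays fixed iff \<open>x\<close> is one of its \<open>2 ^ s\<close> elements.
  Such an \<open>x\<close> keeps the pair span if \<open>(x, hd xs)\<close> already lies in it,
  which lowers the excess index by nothing, and otherwise enlarges it by one dimension. The three
  terms are: stationary tail with the pair already present, stationary tail with a new pair, growing
  tail, where the pair is always new.\<close>

lemma card_stationary_Cons:
  fixes xs :: "'a::{elementary_2_group, finite} list"
  assumes len: "length xs = Suc k"
  shows "real (card {x. x # xs \<in> stationary_lists (Suc k) s (Suc e)}) =
    2 ^ e * of_bool (xs \<in> stationary_lists k s (Suc e)) +
    (2 ^ s - 2 ^ e / 2) * of_bool (xs \<in> stationary_lists k s e) +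
    2 ^ s * of_bool (xs \<in> growing_lists k s e)" (is "real (card ?X) = ?rhs")
proof (cases "gdim xs = s")
  case False
  then show ?thesis
    by (auto simp: stationary_lists_def growing_lists_def)
next
  case True
  have ne: "xs \<noteq> []"
    using len by auto
  let ?w = "gdim (cpairs xs)"
  define F where "F = {x. (x, hd xs) \<in> gspan (cpairs xs)}"
  have F: "F \<subseteq> gspan xs"
    using gspan_cpairs_fst unfolding F_def by blast
  have "x # xs \<in> stationary_lists (Suc k) s (Suc e) \<longleftrightarrow>
      x \<in> gspan xs \<and> (if x \<in> F then ?w = s + e else Suc ?w = s + e)" for x
    unfolding stationary_lists_def mem_Collect_eq list.sel(3) cpairs_Cons[OF ne] F_def
    using len True by simp
  then have X: "?X = (if ?w = s + e then F else {}) \<union> (if Suc ?w = s + e then gspan xs - F else {})"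
    using F by (auto split: if_splits)
  have xs: "xs = hd xs # tl xs"
    using ne by simp
  show ?thesis
  proof (cases "hd xs \<in> gspan (tl xs)")
    case hd: True
    then have tl: "gdim (tl xs) = s"
      using True xs by (metis gdim.simps(2))
    have w: "s \<le> ?w"
      using gdim_tl_le[of xs] tl by simp
    have "2 ^ s * card F = (2::nat) ^ ?w"
      using card_fibre_gspan_cpairs[OF hd] tl by (simp add: F_def)
    also have "\<dots> = 2 ^ s * 2 ^ (?w - s)"
      using w by (simp flip: power_add)
    finally have cF: "card F = 2 ^ (?w - s)"
      by simp
    have "card (gspan xs - F) = 2 ^ s - card F"
      using F by (simp add: card_Diff_subset finite_subset card_gspan True)
    moreover have "card F \<le> 2 ^ s"
      using card_mono[OF finite_gspan F] by (simp add: card_gspan True)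
    ultimately have cD: "real (card (gspan xs - F)) = 2 ^ s - 2 ^ (?w - s)"
      using cF by (simp add: of_nat_diff)
    have half: "(2::real) ^ e / 2 = 2 ^ (?w - s)" if "Suc ?w = s + e"
      using that w by (cases e) auto
    show ?thesis
      unfolding X using True tl len cF cD half
      by (auto simp: stationary_lists_def growing_lists_def)
  next
    case hd: False
    then have tl: "Suc (gdim (tl xs)) = s"
      using True xs by (metis gdim.simps(2))
    \<comment> \<open>A pair with second component \<open>hd xs\<close> would put
      \<open>hd xs\<close> into the tail span.\<close>
    have "F = {}"
      using hd snd_gspan_cpairs[of xs] by (force simp: F_def)
    then show ?thesis
      unfolding X using True tl len
      by (auto simp: stationary_lists_def growing_lists_def card_gspan)
  qed
qed

text \<open>First components of the pair span lie in \<open>gspan xs\<close>. So a vector outside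
  \<open>gspan xs\<close> enlarges both spans by one dimension and keeps \<open>e\<close>.\<close>

lemma card_growing_Cons:
  fixes xs :: "'a::{elementary_2_group, finite} list"
  assumes len: "length xs = Suc k"
  shows "real (card {x. x # xs \<in> growing_lists (Suc k) (Suc s) e}) =
    (real CARD('a) - 2 ^ s) *
    (of_bool (xs \<in> stationary_lists k s e) + of_bool (xs \<in> growing_lists k s e))"
proof -
  have ne: "xs \<noteq> []"
    using len by auto
  have F: "(x, hd xs) \<notin> gspan (cpairs xs)" if "x \<notin> gspan xs" for x
    using that gspan_cpairs_fst by blast
  have "{x. x # xs \<in> growing_lists (Suc k) (Suc s) e} =
      (if gdim xs = s \<and> Suc (gdim (cpairs xs)) = s + e then - gspan xs else {})"
    using len ne F by (auto simp: growing_lists_def cpairs_Cons)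
  moreover have "real (card (- gspan xs)) = real CARD('a) - 2 ^ s" if "gdim xs = s"
  proof -
    have "card (gspan xs) \<le> CARD('a)"
      by (intro card_mono) auto
    then show ?thesis
      using that by (simp add: Compl_eq_Diff_UNIV card_Diff_subset of_nat_diff card_gspan)
  qed
  moreover have "gdim (tl xs) = gdim xs \<or> Suc (gdim (tl xs)) = gdim xs"
    using ne by (cases xs) auto
  ultimately show ?thesis
    using len by (auto simp: stationary_lists_def growing_lists_def)
qed

lemma card_stationary_Suc:
  "real (card (stationary_lists (Suc k) s (Suc e) :: 'a::{elementary_2_group, finite} list set)) =
    2 ^ e * real (card (stationary_lists k s (Suc e) :: 'a list set)) +
    (2 ^ s - 2 ^ e / 2) * real (card (stationary_lists k s e :: 'a list set)) +
    2 ^ s * real (card (growing_lists k s e :: 'a list set))"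
proof -
  let ?L = "{xs :: 'a list. length xs = Suc k}"
  have stationary: "(\<Sum>xs\<in>?L. of_bool (xs \<in> stationary_lists k s e)) =
      real (card (stationary_lists k s e :: 'a list set))" for e
    by (intro sum_of_bool_card finite_lists_length) (auto simp: stationary_lists_def)
  have growing: "(\<Sum>xs\<in>?L. of_bool (xs \<in> growing_lists k s e)) =
      real (card (growing_lists k s e :: 'a list set))"
    by (intro sum_of_bool_card finite_lists_length) (auto simp: growing_lists_def)
  have "stationary_lists (Suc k) s (Suc e) =
      {xs :: 'a list. length xs = Suc (Suc k) \<and> xs \<in> stationary_lists (Suc k) s (Suc e)}"
    by (auto simp: stationary_lists_def)
  then have "real (card (stationary_lists (Suc k) s (Suc e) :: 'a list set)) =
      real (card {xs :: 'a list. length xs = Suc (Suc k) \<and> xs \<in> stationary_lists (Suc k) s (Suc e)})"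
    by (rule arg_cong)
  also have "\<dots> = real (\<Sum>xs\<in>?L. card {x. x # xs \<in> stationary_lists (Suc k) s (Suc e)})"
    unfolding card_lists_Suc ..
  also have "\<dots> = (\<Sum>xs\<in>?L. 2 ^ e * of_bool (xs \<in> stationary_lists k s (Suc e)) +
      (2 ^ s - 2 ^ e / 2) * of_bool (xs \<in> stationary_lists k s e) +
      2 ^ s * of_bool (xs \<in> growing_lists k s e))"
    unfolding of_nat_sum by (intro sum.cong refl card_stationary_Cons) simp
  also have "\<dots> = 2 ^ e * (\<Sum>xs\<in>?L. of_bool (xs \<in> stationary_lists k s (Suc e))) +
      (2 ^ s - 2 ^ e / 2) * (\<Sum>xs\<in>?L. of_bool (xs \<in> stationary_lists k s e)) +
      2 ^ s * (\<Sum>xs\<in>?L. of_bool (xs \<in> growing_lists k s e))"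
    by (simp add: sum.distrib sum_distrib_left)
  finally show ?thesis
    unfolding stationary growing .
qed

lemma card_growing_Suc:
  "real (card (growing_lists (Suc k) (Suc s) e :: 'a::{elementary_2_group, finite} list set)) =
    (real CARD('a) - 2 ^ s) *
    (real (card (stationary_lists k s e :: 'a list set)) +
     real (card (growing_lists k s e :: 'a list set)))"
proof -
  let ?L = "{xs :: 'a list. length xs = Suc k}"
  have stationary: "(\<Sum>xs\<in>?L. of_bool (xs \<in> stationary_lists k s e)) =
      real (card (stationary_lists k s e :: 'a list set))" for e
    by (intro sum_of_bool_card finite_lists_length) (auto simp: stationary_lists_def)
  have growing: "(\<Sum>xs\<in>?L. of_bool (xs \<in> growing_lists k s e)) =
      real (card (growing_lists k s e :: 'a list set))"
    by (intro sum_of_bool_card finite_lists_length) (auto simp: growing_lists_def)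
  have "growing_lists (Suc k) (Suc s) e =
      {xs :: 'a list. length xs = Suc (Suc k) \<and> xs \<in> growing_lists (Suc k) (Suc s) e}"
    by (auto simp: growing_lists_def)
  then have "real (card (growing_lists (Suc k) (Suc s) e :: 'a list set)) =
      real (card {xs :: 'a list. length xs = Suc (Suc k) \<and> xs \<in> growing_lists (Suc k) (Suc s) e})"
    by (rule arg_cong)
  also have "\<dots> = real (\<Sum>xs\<in>?L. card {x. x # xs \<in> growing_lists (Suc k) (Suc s) e})"
    unfolding card_lists_Suc ..
  also have "\<dots> = (\<Sum>xs\<in>?L. (real CARD('a) - 2 ^ s) *
      (of_bool (xs \<in> stationary_lists k s e) + of_bool (xs \<in> growing_lists k s e)))"
    unfolding of_nat_sum by (intro sum.cong refl card_growing_Cons) simp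
  also have "\<dots> = (real CARD('a) - 2 ^ s) *
      ((\<Sum>xs\<in>?L. of_bool (xs \<in> stationary_lists k s e)) +
       (\<Sum>xs\<in>?L. of_bool (xs \<in> growing_lists k s e)))"
    by (simp add: sum.distrib sum_distrib_left distrib_left)
  finally show ?thesis
    unfolding stationary growing .
qed

text \<open>With \<open>e = 0\<close> the pair span would have smaller dimension than its
  projection, the tail span.\<close>

lemma stationary_lists_0_right [simp]:
  "stationary_lists k s 0 = ({} :: 'a::{elementary_2_group, finite} list set)"
proof -
  have "xs \<notin> stationary_lists k s 0" for xs :: "'a list"
    using gdim_tl_le[of xs] by (auto simp: stationary_lists_def)
  then show ?thesis
    by blast
qed

lemma growing_lists_0_left [simp]: "growing_lists k 0 e = {}"
  by (auto simp: growing_lists_def)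

section \<open>Gaussian binomial coefficients\<close>

text \<open>The q-Pascal rule at q = 2; real values allow differences and division.\<close>

fun qbinomial :: "nat \<Rightarrow> nat \<Rightarrow> real" where
  "qbinomial n 0 = 1"
| "qbinomial 0 (Suc k) = 0"
| "qbinomial (Suc n) (Suc k) = 2 ^ Suc k * qbinomial n (Suc k) + qbinomial n k"

text \<open>The q-analogue of \<open>(n - k) * (n choose k) = (k + 1) * (n choose (k + 1))\<close>,
  scaled by \<open>2 ^ k\<close> to avoid \<open>n - k\<close> as an exponent. The Pascal rule
  reduces it to the induction hypothesis at two neighbouring indices.\<close>

lemma qbinomial_absorption:
  "(2 ^ n - 2 ^ k) * qbinomial n k = 2 ^ k * (2 ^ Suc k - 1) * qbinomial n (Suc k)"
proof (induction n arbitrary: k)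
  case 0
  show ?case by (cases k) auto
next
  case (Suc n)
  show ?case
  proof (cases k)
    case 0
    then show ?thesis
      using Suc.IH[of 0] by simp
  next
    case (Suc j)
    let ?a = "qbinomial n j" and ?b = "qbinomial n (Suc j)" and ?c = "qbinomial n (Suc (Suc j))"
    have "(2 ^ Suc n - 2 ^ k) * qbinomial (Suc n) k =
        4 * 2 ^ j * (2 ^ n - 2 ^ j) * ?b + 2 * ((2 ^ n - 2 ^ j) * ?a)"
      by (simp add: Suc algebra_simps)
    also have "\<dots> = 2 * 2 ^ j * (2 * 2 ^ n - 1) * ?b"
      unfolding Suc.IH[of j] by (simp add: algebra_simps)
    also have "\<dots> = 4 * 2 ^ j * ((2 ^ n - 2 ^ Suc j) * ?b) + 2 * 2 ^ j * (4 * 2 ^ j - 1) * ?b"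
      by (simp add: algebra_simps)
    also have "\<dots> = 2 ^ k * (2 ^ Suc k - 1) * qbinomial (Suc n) (Suc k)"
      unfolding Suc.IH[of "Suc j"] by (simp add: Suc algebra_simps)
    finally show ?thesis .
  qed
qed

lemma qbinomial_Suc_right:
  "qbinomial n (Suc k) = (2 ^ n - 2 ^ k) * qbinomial n k / (2 ^ k * (2 ^ Suc k - 1))"
proof -
  have "(2::real) ^ Suc k \<noteq> 1"
    using one_less_power[of "2::real" "Suc k"] by simp
  then show ?thesis
    unfolding qbinomial_absorption by simp
qed

text \<open>The second q-Pascal rule, again cleared of the exponent \<open>n - k\<close>.\<close>

lemma qbinomial_Suc_Suc':
  "2 ^ k * qbinomial (Suc n) (Suc k) = 2 ^ n * qbinomial n k + 2 ^ k * qbinomial n (Suc k)"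
  using qbinomial_absorption[of n k] by (simp add: algebra_simps)

section \<open>Closed form\<close>

text \<open>For \<open>N = |V|\<close>, the number of sequences of \<open>s\<close> linearly independent vectors of \<open>V\<close>.\<close>

definition chain_count :: "real \<Rightarrow> nat \<Rightarrow> real" where
  "chain_count N s = (\<Prod>j<s. N - 2 ^ j)"

lemma chain_count_Suc: "chain_count N (Suc s) = (N - 2 ^ s) * chain_count N s"
  by (simp add: chain_count_def mult.commute)

lemma card_stationary_0:
  "card (stationary_lists 0 s e :: 'a::{elementary_2_group, finite} list set) =
    of_bool (s = 0 \<and> e = 1)"
proof -
  have "xs \<in> stationary_lists 0 s e \<longleftrightarrow> s = 0 \<and> e = 1 \<and> xs = [0]" for xs :: "'a list"
    by (cases xs) (auto simp: stationary_lists_def)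
  then have "stationary_lists 0 s e = (if s = 0 \<and> e = 1 then {[0 :: 'a]} else {})"
    by auto
  then show ?thesis
    by simp
qed

lemma card_growing_0:
  "card (growing_lists 0 s e :: 'a::{elementary_2_group, finite} list set) =
    of_bool (s = 1 \<and> e = 0) * (CARD('a) - 1)"
proof -
  have "xs \<in> growing_lists 0 s e \<longleftrightarrow> s = 1 \<and> e = 0 \<and> (\<exists>x. x \<noteq> 0 \<and> xs = [x])" for xs :: "'a list"
    by (cases xs) (auto simp: growing_lists_def)
  then have "growing_lists 0 s e = (if s = 1 \<and> e = 0 then (\<lambda>x. [x]) ` (- {0 :: 'a}) else {})"
    by auto
  moreover have "card ((\<lambda>x. [x]) ` (- {0 :: 'a})) = CARD('a) - 1"
    by (subst card_image) (auto simp: inj_on_def Compl_eq_Diff_UNIV card_Diff_subset)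
  ultimately show ?thesis
    by simp
qed

text \<open>The products satisfy the initial values and both recursions, which are coupled, hence
  the joint induction. Growing lists with index 0 stand apart: they are independent, so
  \<open>s\<close> equals their length.\<close>

lemma stationary_growing_closed_form:
  fixes k s d :: nat
  defines "N \<equiv> real CARD('a::{elementary_2_group, finite})"
  shows "real (card (stationary_lists k s (Suc d) :: 'a list set)) =
      (if s \<le> k then chain_count N s * 2 ^ (s + d * d) * qbinomial (k - s) d * qbinomial s d else 0)"
    and "real (card (growing_lists k s 0 :: 'a list set)) =
      (if s = Suc k then chain_count N s else 0)"
    and "real (card (growing_lists k s (Suc d) :: 'a list set)) =
      (if s \<le> k then chain_count N s * 2 ^ (d * Suc d) * qbinomial (k - s) d * qbinomial s (Suc d)
       else 0)"
proof (induction k arbitrary: s d)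
  case 0
  have "1 \<le> CARD('a)"
    by (simp add: Suc_le_eq)
  {
    case 1
    show ?case by (cases d) (auto simp: card_stationary_0 chain_count_def)
  next
    case 2
    show ?case using \<open>1 \<le> CARD('a)\<close>
      by (auto simp: card_growing_0 chain_count_def N_def of_nat_diff)
  next
    case 3
    show ?case by (auto simp: card_growing_0)
  }
next
  case (Suc k)
  {
    case 1
    show ?case
    proof (cases d)
      case 0
      \<comment> \<open>The independent lists with \<open>s = Suc k\<close> enter here and extend
        the range from \<open>s \<le> k\<close> to \<open>s \<le> Suc k\<close>.\<close>
      then show ?thesis
        using Suc(1)[of s 0] Suc(2)[of s] by (auto simp: card_stationary_Suc)
    next
      case d: (Suc c)
      have "real (card (stationary_lists (Suc k) s (Suc d) :: 'a list set)) =
          2 ^ d * real (card (stationary_lists k s (Suc d) :: 'a list set)) +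
          (2 ^ s - 2 ^ c) * real (card (stationary_lists k s (Suc c) :: 'a list set)) +
          2 ^ s * real (card (growing_lists k s (Suc c) :: 'a list set))"
        by (simp add: card_stationary_Suc d)
      also have "\<dots> = (if s \<le> Suc k then chain_count N s * 2 ^ (s + d * d) *
          qbinomial (Suc k - s) d * qbinomial s d else 0)"
      proof (cases "s \<le> k")
        case True
        let ?A = "chain_count N s" and ?m = "k - s"
        have "2 ^ d * (?A * 2 ^ (s + d * d) * qbinomial ?m d * qbinomial s d) +
            (2 ^ s - 2 ^ c) * (?A * 2 ^ (s + c * c) * qbinomial ?m c * qbinomial s c) +
            2 ^ s * (?A * 2 ^ (c * Suc c) * qbinomial ?m c * qbinomial s (Suc c)) =
            ?A * 2 ^ s * (2 ^ d * 2 ^ (d * d) * qbinomial ?m d * qbinomial s d +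
            qbinomial ?m c * (2 ^ (c * c) * ((2 ^ s - 2 ^ c) * qbinomial s c) +
              2 ^ (c * Suc c) * qbinomial s (Suc c)))"
          by (simp add: algebra_simps power_add)
        \<comment> \<open>Absorption merges the stationary and growing contributions of index
          \<open>Suc c\<close> into one term.\<close>
        also have "2 ^ (c * c) * ((2 ^ s - 2 ^ c) * qbinomial s c) +
            2 ^ (c * Suc c) * qbinomial s (Suc c) = 2 ^ (d * d) * qbinomial s d"
          unfolding qbinomial_absorption by (simp add: d power_add algebra_simps)
        also have "?A * 2 ^ s * (2 ^ d * 2 ^ (d * d) * qbinomial ?m d * qbinomial s d +
            qbinomial ?m c * (2 ^ (d * d) * qbinomial s d)) =
            ?A * 2 ^ (s + d * d) * (2 ^ d * qbinomial ?m d + qbinomial ?m c) * qbinomial s d"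
          by (simp add: algebra_simps power_add)
        \<comment> \<open>This is the defining Pascal rule in the upper index
          \<open>k - s\<close>.\<close>
        also have "2 ^ d * qbinomial ?m d + qbinomial ?m c = qbinomial (Suc k - s) d"
          using True by (simp add: d Suc_diff_le)
        finally show ?thesis
          using True Suc(1)[of s d] Suc(1)[of s c] Suc(3)[of s c] by simp
      next
        case False
        \<comment> \<open>For \<open>s = Suc k\<close> the closed form contains
          \<open>qbinomial 0 d\<close> with \<open>d > 0\<close>, which is 0.\<close>
        then show ?thesis
          using Suc(1)[of s d] Suc(1)[of s c] Suc(3)[of s c] by (auto simp: d)
      qed
      finally show ?thesis .
    qed
  next
    case 2
    show ?case
    proof (cases s)
      case s: (Suc t)
      then show ?thesis
        using Suc(2)[of t] by (simp add: card_growing_Suc chain_count_Suc N_def)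
    qed simp
  next
    case 3
    show ?case
    proof (cases s)
      case s: (Suc t)
      have "real (card (growing_lists (Suc k) s (Suc d) :: 'a list set)) =
          (N - 2 ^ t) * (real (card (stationary_lists k t (Suc d) :: 'a list set)) +
          real (card (growing_lists k t (Suc d) :: 'a list set)))"
        by (simp add: s card_growing_Suc N_def)
      also have "\<dots> = (if t \<le> k then (N - 2 ^ t) *
          (chain_count N t * 2 ^ (d * d) * qbinomial (k - t) d *
           (2 ^ t * qbinomial t d + 2 ^ d * qbinomial t (Suc d))) else 0)"
        using Suc(1)[of t d] Suc(3)[of t d] by (simp add: power_add algebra_simps)
      also have "\<dots> = (if s \<le> Suc k then chain_count N s * 2 ^ (d * Suc d) *
          qbinomial (Suc k - s) d * qbinomial s (Suc d) else 0)"
        unfolding qbinomial_Suc_Suc'[symmetric]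
        by (simp add: s chain_count_Suc power_add algebra_simps)
      finally show ?thesis .
    qed simp
  }
qed

text \<open>Lists are sorted by the dimension \<open>s\<close> of their span, at most
  \<open>Suc i\<close>; the second Pascal rule then adds the stationary and growing counts.\<close>

lemma card_lists_gdim_cpairs:
  fixes k i :: nat
  defines "N \<equiv> real CARD('a::{elementary_2_group, finite})"
  assumes "i \<le> k"
  shows "real (card {xs :: 'a list. length xs = Suc k \<and> gdim (cpairs xs) = i}) =
    (\<Sum>s\<le>i. chain_count N s * 2 ^ ((i - s) * Suc (i - s)) * qbinomial (k - s) (i - s) *
       qbinomial (Suc s) (Suc (i - s))) + (if i = k then chain_count N (Suc i) else 0)"
proof -
  let ?S = "\<lambda>s. stationary_lists k s (Suc i - s) \<union> growing_lists k s (Suc i - s) :: 'a list set"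
  let ?c = "\<lambda>s. real (card (?S s))"
  have fin: "finite (stationary_lists k s e :: 'a list set)" "finite (growing_lists k s e :: 'a list set)"
    for s e
    by (auto simp: stationary_lists_def growing_lists_def
        intro: finite_subset[OF _ finite_lists_length[of "Suc k"]])
  have card_S: "?c s = real (card (stationary_lists k s (Suc i - s) :: 'a list set)) +
      real (card (growing_lists k s (Suc i - s) :: 'a list set))" for s
    using fin by (subst card_Un_disjoint) (auto simp: stationary_lists_def growing_lists_def)
  have "{xs :: 'a list. length xs = Suc k \<and> gdim (cpairs xs) = i} = (\<Union>s\<in>{..Suc i}. ?S s)"
  proof (intro equalityI subsetI)
    fix xs :: "'a list"
    assume xs: "xs \<in> {xs. length xs = Suc k \<and> gdim (cpairs xs) = i}"
    have "gdim (tl xs) = gdim xs \<or> Suc (gdim (tl xs)) = gdim xs"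
      by (cases xs) auto
    moreover have "gdim xs \<le> Suc i"
      using gdim_le_Suc_gdim_tl[of xs] gdim_tl_le[of xs] xs by simp
    ultimately have "xs \<in> ?S (gdim xs)"
      using xs by (auto simp: stationary_lists_def growing_lists_def)
    then show "xs \<in> (\<Union>s\<in>{..Suc i}. ?S s)"
      using \<open>gdim xs \<le> Suc i\<close> by blast
  qed (auto simp: stationary_lists_def growing_lists_def)
  then have "real (card {xs :: 'a list. length xs = Suc k \<and> gdim (cpairs xs) = i}) =
      real (card (\<Union>s\<in>{..Suc i}. ?S s))"
    by simp
  also have "card (\<Union>s\<in>{..Suc i}. ?S s) = (\<Sum>s\<le>Suc i. card (?S s))"
  proof (rule card_UN_disjoint)
    show "\<forall>s\<in>{..Suc i}. finite (?S s)"
      using fin by blast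
  qed (auto simp: stationary_lists_def growing_lists_def)
  also have "real (\<Sum>s\<le>Suc i. card (?S s)) = (\<Sum>s\<le>i. ?c s) + ?c (Suc i)"
    by simp
  \<comment> \<open>For \<open>s = Suc i\<close> the index \<open>e\<close> is 0, so only
    independent lists remain, and their length forces \<open>i = k\<close>.\<close>
  also have "?c (Suc i) = (if i = k then chain_count N (Suc i) else 0)"
    using card_S[of "Suc i"] stationary_growing_closed_form(2)[where 'a = 'a, of k "Suc i"]
    by (simp add: N_def)
  also have "(\<Sum>s\<le>i. ?c s) = (\<Sum>s\<le>i. chain_count N s * 2 ^ ((i - s) * Suc (i - s)) *
      qbinomial (k - s) (i - s) * qbinomial (Suc s) (Suc (i - s)))"
  proof (intro sum.cong refl)
    fix s assume "s \<in> {..i}"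
    then obtain e where i: "i = s + e"
      using le_Suc_ex by auto
    have s: "s \<le> k" "Suc i - s = Suc e" "i - s = e"
      using i \<open>i \<le> k\<close> by auto
    have "?c s = real (card (stationary_lists k s (Suc e) :: 'a list set)) +
        real (card (growing_lists k s (Suc e) :: 'a list set))"
      using card_S[of s] by (simp only: s)
    also have "\<dots> = chain_count N s * 2 ^ (e * e) * qbinomial (k - s) e *
        (2 ^ s * qbinomial s e + 2 ^ e * qbinomial s (Suc e))"
      unfolding stationary_growing_closed_form N_def[symmetric]
      using s(1) by (simp add: power_add algebra_simps)
    also have "\<dots> = chain_count N s * 2 ^ (e * Suc e) *
        qbinomial (k - s) e * qbinomial (Suc s) (Suc e)"
      unfolding qbinomial_Suc_Suc'[symmetric] by (simp add: power_add algebra_simps)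
    finally show "?c s = chain_count N s * 2 ^ ((i - s) * Suc (i - s)) *
        qbinomial (k - s) (i - s) * qbinomial (Suc s) (Suc (i - s))"
      by (simp only: s)
  qed
  finally show ?thesis .
qed

section \<open>Matrix rank and cardinality of spans\<close>

text \<open>Coordinates with respect to a basis are unique.\<close>

lemma (in vectorspace) card_carrier:
  assumes "fin_dim"
  shows "card (carrier V) = card (carrier K) ^ dim"
proof -
  obtain B where B: "finite B" "basis B"
    using finite_basis_exists[OF assms] by blast
  then have "B \<subseteq> carrier V"
    by (simp add: basis_def)
  have "bij_betw (\<lambda>a. lincomb a B) (B \<rightarrow>\<^sub>E carrier K) (carrier V)"
  proof (rule bij_betwI')
    fix a b assume a: "a \<in> B \<rightarrow>\<^sub>E carrier K" and b: "b \<in> B \<rightarrow>\<^sub>E carrier K"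
    have "lincomb a B \<in> carrier V"
      using a \<open>B \<subseteq> carrier V\<close> by (intro lincomb_closed) (auto simp: PiE_def)
    then show "(lincomb a B = lincomb b B) = (a = b)"
      using basis_criterion[OF B(1) \<open>B \<subseteq> carrier V\<close>] B(2) a b by metis
  next
    fix a assume "a \<in> B \<rightarrow>\<^sub>E carrier K"
    then show "lincomb a B \<in> carrier V"
      using \<open>B \<subseteq> carrier V\<close> by (intro lincomb_closed) (auto simp: PiE_def)
  next
    fix v assume "v \<in> carrier V"
    then show "\<exists>a\<in>B \<rightarrow>\<^sub>E carrier K. v = lincomb a B"
      using basis_criterion[OF B(1) \<open>B \<subseteq> carrier V\<close>] B(2) by metis
  qed
  then have "card (carrier V) = card (B \<rightarrow>\<^sub>E carrier K)"
    by (simp add: bij_betw_same_card)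
  also have "\<dots> = card (carrier K) ^ card B"
    using B(1) by (simp add: card_PiE)
  finally show ?thesis
    using dim_basis[OF B] by simp
qed

text \<open>Turns the rank, the dimension of a column span, into a cardinality comparable with
  \<open>card_gspan\<close>.\<close>

lemma (in vectorspace) card_span:
  assumes "S \<subseteq> carrier V" "finite S"
  shows "card (span S) = card (carrier K) ^ vectorspace.dim K (span_vs S)"
proof -
  have W: "vectorspace K (span_vs S)"
    using assms(1) by (metis span_is_subspace subspace_is_vs)
  have "LinearCombinations.module.gen_set K (span_vs S) S"
    using module.span_li_not_depend(1)[OF in_own_span[OF assms(1)] span_is_submodule[OF assms(1)]]
    by simp
  then have "vectorspace.fin_dim K (span_vs S)"
    using assms in_own_span[OF assms(1)] vectorspace.fin_dim_def[OF W] by auto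
  then show ?thesis
    using vectorspace.card_carrier[OF W] by simp
qed

text \<open>The only scalars are 0 and 1, so linear span and generated subgroup agree; the additive
  map \<open>f\<close> carries one to the other.\<close>

lemma bit_span_eq_gspan_image:
  fixes f :: "'a::elementary_2_group \<Rightarrow> bit vec"
  assumes f: "\<And>x. f x \<in> carrier_vec n" "\<And>x y. f (x + y) = f x + f y"
  shows "LinearCombinations.module.span class_ring (module_vec TYPE(bit) n) (f ` set xs) = f ` gspan xs"
proof -
  interpret V: vec_space "TYPE(bit)" n .
  have f0: "f 0 = 0\<^sub>v n"
  proof -
    have "f 0 = f 0 + f 0"
      using f(2)[of 0 0] by simp
    moreover have "v + v = 0\<^sub>v n" if "v \<in> carrier_vec n" for v :: "bit vec"
      using that by (intro eq_vecI) auto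
    ultimately show ?thesis
      using f(1) by metis
  qed
  have sub: "f ` set xs \<subseteq> carrier_vec n"
    using f(1) by auto
  show ?thesis
  proof
    have "submodule class_ring (f ` gspan xs) V.V"
    proof (rule submodule.intro)
      show "Module.module class_ring V.V"
        by (rule V.module_axioms)
      show "v \<oplus>\<^bsub>V.V\<^esub> w \<in> f ` gspan xs" if "v \<in> f ` gspan xs" "w \<in> f ` gspan xs" for v w
        using that by (auto simp: f(2)[symmetric] gspan_add)
      show "c \<odot>\<^bsub>V.V\<^esub> v \<in> f ` gspan xs" if "v \<in> f ` gspan xs" for c :: bit and v
        using that f(1) by (cases c) (auto simp: f0[symmetric])
    qed (use f(1) f0 in \<open>auto simp: image_iff intro!: bexI[of _ 0]\<close>)
    moreover have "f ` set xs \<subseteq> f ` gspan xs"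
      by (intro image_mono) (induction xs, auto)
    ultimately show "V.span (f ` set xs) \<subseteq> f ` gspan xs"
      by (rule V.span_is_subset[rotated])
    define S where "S = V.span (f ` set xs)"
    have zero: "0\<^sub>v n \<in> S"
      unfolding S_def using submodule.zero_closed[OF V.span_is_submodule[OF sub]]
      by (simp only: module_vec_simps)
    have mem: "f x \<in> S" if "x \<in> set xs" for x
      unfolding S_def using that by (intro V.span_mem[OF sub] imageI)
    have add: "v + w \<in> S" if "v \<in> S" "w \<in> S" for v w
      using V.span_add1[OF sub that[unfolded S_def]] by (simp only: S_def module_vec_simps)
    \<comment> \<open>Generalised to lists \<open>ys\<close> with entries from \<open>xs\<close>, so
      that \<open>S\<close> stays fixed during the induction.\<close>
    have "f ` gspan ys \<subseteq> S" if "set ys \<subseteq> set xs" for ys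
      using that
    proof (induction ys)
      case Nil
      show ?case
        by (simp add: f0 zero)
    next
      case (Cons y ys)
      have "f y \<in> S"
        using mem Cons.prems by simp
      then show ?case
        using Cons by (auto simp: f(2) image_subset_iff intro!: add)
    qed
    then show "f ` gspan xs \<subseteq> V.span (f ` set xs)"
      unfolding S_def by simp
  qed
qed

section \<open>Tuples as lists of vectors with five coordinates\<close>

type_synonym bit5 = "bit \<times> bit \<times> bit \<times> bit \<times> bit"

text \<open>Indices start at 1 as in the tuples; every index outside \<open>1..4\<close> falls to
  the fifth coordinate.\<close>

fun coord :: "bit5 \<Rightarrow> nat \<Rightarrow> bit" where
  "coord (a, b, c, d, e) l = 
    (if l = 1 then a else if l = 2 then b else if l = 3 then c else if l = 4 then d else e)"

text \<open>The two components are interleaved, as the two rows of each Hankel block are adjacent in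
  the matrix.\<close>

definition pair_vec :: "bit5 \<times> bit5 \<Rightarrow> bit vec" where
  "pair_vec p = vec 10 (\<lambda>r. coord (if even r then fst p else snd p) (r div 2 + 1))"

definition tuple_list :: "nat \<Rightarrow> (nat \<times> nat \<Rightarrow> bit) \<Rightarrow> bit5 list" where
  "tuple_list k \<alpha> = map (\<lambda>j. (\<alpha> (1, j), \<alpha> (2, j), \<alpha> (3, j), \<alpha> (4, j), \<alpha> (5, j))) [1..<k + 2]"

lemma coord_add: "coord (x + y) l = coord x l + coord y l"
  by (cases x; cases y) simp

lemma coord_eqI:
  assumes "\<And>l. 1 \<le> l \<Longrightarrow> l \<le> 5 \<Longrightarrow> coord x l = coord y l"
  shows "x = y"
proof -
  have "coord x 1 = coord y 1" "coord x 2 = coord y 2" "coord x 3 = coord y 3"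
    "coord x 4 = coord y 4" "coord x 5 = coord y 5"
    using assms by simp_all
  then show ?thesis
    by (cases x; cases y) simp
qed

lemma coord_tuple_list:
  assumes "1 \<le> l" "l \<le> 5" "j \<le> k"
  shows "coord (tuple_list k \<alpha> ! j) l = \<alpha> (l, j + 1)"
proof -
  have "tuple_list k \<alpha> ! j =
      (\<alpha> (1, j + 1), \<alpha> (2, j + 1), \<alpha> (3, j + 1), \<alpha> (4, j + 1), \<alpha> (5, j + 1))"
    using assms(3) by (simp add: tuple_list_def del: upt_Suc)
  moreover have "l = 1 \<or> l = 2 \<or> l = 3 \<or> l = 4 \<or> l = 5"
    using assms by linarith
  ultimately show ?thesis
    by (elim disjE) simp_all
qed

lemma length_tuple_list [simp]: "length (tuple_list k \<alpha>) = Suc k"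
  by (simp add: tuple_list_def)

lemma pair_vec_carrier: "pair_vec p \<in> carrier_vec 10"
  by (simp add: pair_vec_def)

lemma pair_vec_add: "pair_vec (p + q) = pair_vec p + pair_vec q"
  by (intro eq_vecI) (auto simp: pair_vec_def coord_add)

lemma inj_pair_vec: "inj pair_vec"
proof (rule injI)
  fix p q assume eq: "pair_vec p = pair_vec q"
  have nth: "coord (if even r then fst p else snd p) (r div 2 + 1) =
      coord (if even r then fst q else snd q) (r div 2 + 1)" if "r < 10" for r
    using arg_cong[OF eq, of "\<lambda>v. v $ r"] that by (simp add: pair_vec_def)
  have "fst p = fst q"
  proof (rule coord_eqI)
    fix l :: nat assume "1 \<le> l" "l \<le> 5"
    then show "coord (fst p) l = coord (fst q) l"
      using nth[of "2 * (l - 1)"] by simp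
  qed
  moreover have "snd p = snd q"
  proof (rule coord_eqI)
    fix l :: nat assume "1 \<le> l" "l \<le> 5"
    then show "coord (snd p) l = coord (snd q) l"
      using nth[of "Suc (2 * (l - 1))"] by simp
  qed
  ultimately show "p = q"
    by (simp add: prod_eq_iff)
qed

lemma cols_persym_mat: "cols (persym_mat k \<alpha>) = map pair_vec (cpairs (tuple_list k \<alpha>))"
proof (rule nth_equalityI)
  show "length (cols (persym_mat k \<alpha>)) = length (map pair_vec (cpairs (tuple_list k \<alpha>)))"
    by (simp add: persym_mat_def)
next
  fix c assume "c < length (cols (persym_mat k \<alpha>))"
  then have c: "c < k"
    by (simp add: persym_mat_def)
  have "cols (persym_mat k \<alpha>) ! c = vec 10 (\<lambda>r. \<alpha> (r div 2 + 1, c + 1 + r mod 2))"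
    using c by (intro eq_vecI) (auto simp: persym_mat_def)
  also have "\<dots> = pair_vec (tuple_list k \<alpha> ! c, tuple_list k \<alpha> ! Suc c)"
    using c by (intro eq_vecI) (auto simp: pair_vec_def coord_tuple_list odd_iff_mod_2_eq_one)
  also have "\<dots> = map pair_vec (cpairs (tuple_list k \<alpha>)) ! c"
    using c by (simp add: nth_tl)
  finally show "cols (persym_mat k \<alpha>) ! c = map pair_vec (cpairs (tuple_list k \<alpha>)) ! c" .
qed

lemma card_UNIV_bit: "CARD(bit) = 2"
proof -
  have "(UNIV :: bit set) = {0, 1}"
    by (auto intro: bit.exhaust)
  then show ?thesis
    by (metis card_2_iff zero_neq_one)
qed

text \<open>Both sides are exponents of 2 in the cardinality of the column span, because
  \<open>pair_vec\<close> is injective.\<close>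

lemma rank_persym_mat: "vec_space.rank 10 (persym_mat k \<alpha>) = gdim (cpairs (tuple_list k \<alpha>))"
proof -
  interpret V: vec_space "TYPE(bit)" 10 .
  let ?ps = "cpairs (tuple_list k \<alpha>)"
  have "V.span (pair_vec ` set ?ps) = pair_vec ` gspan ?ps"
    by (rule bit_span_eq_gspan_image[OF pair_vec_carrier pair_vec_add])
  moreover have "card (V.span (pair_vec ` set ?ps)) = 2 ^ V.rank (persym_mat k \<alpha>)"
  proof -
    have "card (carrier (class_ring :: bit ring)) = 2"
      by (simp add: class_ring_simps card_UNIV_bit)
    moreover have "pair_vec ` set ?ps \<subseteq> carrier_vec 10"
      using pair_vec_carrier by auto
    ultimately show ?thesis
      using V.card_span[of "pair_vec ` set ?ps"]
      by (simp only: V.rank_def cols_persym_mat list.set_map card_UNIV_bit finite_imageI finite_set)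
  qed
  moreover have "card (pair_vec ` gspan ?ps) = 2 ^ gdim ?ps"
    by (simp add: card_image inj_on_subset[OF inj_pair_vec] card_gspan)
  ultimately show ?thesis
    by simp
qed

lemma persym_count_eq:
  "persym_count i k = card {xs :: bit5 list. length xs = Suc k \<and> gdim (cpairs xs) = i}"
proof -
  \<comment> \<open>The inverse of \<open>tuple_list k\<close>: \<open>j - 1\<close> converts to
    list positions, and \<open>restrict\<close> gives an extensional function.\<close>
  let ?g = "\<lambda>xs. restrict (\<lambda>(l, j). coord (xs ! (j - 1)) l) ({1..5} \<times> {1..k + 1})"
  have g: "tuple_list k (?g xs) = xs" if "length xs = Suc k" for xs
  proof (rule nth_equalityI)
    fix j assume "j < length (tuple_list k (?g xs))"
    then show "tuple_list k (?g xs) ! j = xs ! j"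
      by (intro coord_eqI) (simp add: coord_tuple_list)
  qed (use that in simp)
  have g_in: "?g xs \<in> persym_tuples k" for xs
    unfolding persym_tuples_def restrict_PiE_iff by simp
  have "bij_betw (tuple_list k) {\<alpha> \<in> persym_tuples k. vec_space.rank 10 (persym_mat k \<alpha>) = i}
      {xs. length xs = Suc k \<and> gdim (cpairs xs) = i}"
  proof (rule bij_betw_byWitness[of _ ?g])
    show "\<forall>\<alpha>\<in>{\<alpha> \<in> persym_tuples k. vec_space.rank 10 (persym_mat k \<alpha>) = i}.
        ?g (tuple_list k \<alpha>) = \<alpha>"
    proof
      fix \<alpha> assume "\<alpha> \<in> {\<alpha> \<in> persym_tuples k. vec_space.rank 10 (persym_mat k \<alpha>) = i}"
      then have "\<alpha> \<in> extensional ({1..5} \<times> {1..k + 1})"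
        by (auto simp: persym_tuples_def PiE_def)
      then show "?g (tuple_list k \<alpha>) = \<alpha>"
        by (intro extensionalityI[of _ "{1..5} \<times> {1..k + 1}"]) (auto simp: coord_tuple_list)
    qed
    show "?g ` {xs. length xs = Suc k \<and> gdim (cpairs xs) = i} \<subseteq>
        {\<alpha> \<in> persym_tuples k. vec_space.rank 10 (persym_mat k \<alpha>) = i}"
      using g g_in by (auto simp: rank_persym_mat simp del: restrict_apply)
  qed (use g in \<open>auto simp: rank_persym_mat\<close>)
  then show ?thesis
    unfolding persym_count_def by (rule bij_betw_same_card)
qed

lemma card_UNIV_bit5: "CARD(bit5) = 32"
  by (simp add: card_UNIV_bit)

section \<open>Evaluation over five coordinates\<close>

lemma qbinomial_eq_0: "n < k \<Longrightarrow> qbinomial n k = 0"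
  by (induction n k rule: qbinomial.induct) auto

text \<open>The denominator for lower index \<open>m\<close> is the product of
  \<open>2 ^ m - 2 ^ j\<close> over \<open>j < m\<close>, the order of GL(m, 2). Index 6 suffices:
  \<open>chain_count 32 s\<close> is 0 for \<open>s > 5\<close>, and
  \<open>qbinomial (Suc s) (Suc d)\<close> is 0 for \<open>d > s\<close>.\<close>

lemma qbinomial_numeral:
  "qbinomial n (Suc 0) = 2 ^ n - 1"
  "qbinomial n (Suc (Suc 0)) = (2 ^ n - 1) * (2 ^ n - 2) / 6"
  "qbinomial n 2 = (2 ^ n - 1) * (2 ^ n - 2) / 6"
  "qbinomial n 3 = (2 ^ n - 1) * (2 ^ n - 2) * (2 ^ n - 4) / 168"
  "qbinomial n 4 = (2 ^ n - 1) * (2 ^ n - 2) * (2 ^ n - 4) * (2 ^ n - 8) / 20160"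
  "qbinomial n 5 = (2 ^ n - 1) * (2 ^ n - 2) * (2 ^ n - 4) * (2 ^ n - 8) * (2 ^ n - 16) / 9999360"
  "qbinomial n 6 = (2 ^ n - 1) * (2 ^ n - 2) * (2 ^ n - 4) * (2 ^ n - 8) * (2 ^ n - 16) *
     (2 ^ n - 32) / 20158709760"
  by (simp_all add: eval_nat_numeral qbinomial_Suc_right)

lemma chain_count_32:
  "chain_count 32 0 = 1" "chain_count 32 (Suc 0) = 31" "chain_count 32 2 = 930"
  "chain_count 32 3 = 26040" "chain_count 32 4 = 624960" "chain_count 32 5 = 9999360"
  by (simp_all add: chain_count_def eval_nat_numeral)

text \<open>The factor with \<open>j = 5\<close> is \<open>32 - 2 ^ 5\<close>: six vectors in
  dimension five are dependent.\<close>

lemma chain_count_32_eq_0: "6 \<le> s \<Longrightarrow> chain_count 32 s = 0"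
  unfolding chain_count_def by (rule prod_zero) (auto intro!: bexI[of _ 5])

text \<open>For \<open>i = k\<close> the extra term counts \<open>Suc i\<close> independent vectors,
  and \<open>5 \<le> i\<close> makes it vanish. This admits rank 10 at
  \<open>k = 10\<close>.\<close>

lemma persym_count_formula:
  assumes "i \<le> k" "i < k \<or> 5 \<le> i"
  shows "real (persym_count i k) = (\<Sum>s\<le>i. chain_count 32 s * 2 ^ ((i - s) * Suc (i - s)) *
    qbinomial (k - s) (i - s) * qbinomial (Suc s) (Suc (i - s)))"
proof -
  have "i = k \<Longrightarrow> chain_count 32 (Suc i) = 0"
    using assms(2) by (intro chain_count_32_eq_0) auto
  then show ?thesis
    unfolding persym_count_eq card_lists_gdim_cpairs[where 'a = bit5, OF assms(1)] card_UNIV_bit5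
    by simp
qed

lemma sum_atMost_numeral:
  fixes f :: "nat \<Rightarrow> real"
  shows "sum f {..1} = f 0 + f 1"
    "sum f {..2} = f 0 + f 1 + f 2"
    "sum f {..3} = f 0 + f 1 + f 2 + f 3"
    "sum f {..4} = f 0 + f 1 + f 2 + f 3 + f 4"
    "sum f {..5} = f 0 + f 1 + f 2 + f 3 + f 4 + f 5"
    "sum f {..6} = f 0 + f 1 + f 2 + f 3 + f 4 + f 5 + f 6"
    "sum f {..7} = f 0 + f 1 + f 2 + f 3 + f 4 + f 5 + f 6 + f 7"
    "sum f {..8} = f 0 + f 1 + f 2 + f 3 + f 4 + f 5 + f 6 + f 7 + f 8"
    "sum f {..9} = f 0 + f 1 + f 2 + f 3 + f 4 + f 5 + f 6 + f 7 + f 8 + f 9"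
    "sum f {..10} = f 0 + f 1 + f 2 + f 3 + f 4 + f 5 + f 6 + f 7 + f 8 + f 9 + f 10"
  by (simp_all add: eval_nat_numeral)

lemma power5_eq: "x ^ 5 = x * x * x * x * (x :: real)"
  by (simp add: eval_nat_numeral)

lemma int_eqI: "real n = real_of_int z \<Longrightarrow> int n = z"
  using of_int_eq_iff[of "int n" z, where 'a = real] by simp

theorem theorem2p1:
  fixes k :: nat
  assumes "k \<ge> 1"
  shows "(k \<ge> 1 \<longrightarrow> int (persym_count 0 k) = 1)
    \<and> (k \<ge> 2 \<longrightarrow> int (persym_count 1 k) = 93)
    \<and> (k \<ge> 3 \<longrightarrow> int (persym_count 2 k) = 31 * 2 ^ (k + 1) + 6386)
    \<and> (k \<ge> 4 \<longrightarrow> int (persym_count 3 k) = 6510 * 2 ^ k + 364560)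
    \<and> (k \<ge> 5 \<longrightarrow> int (persym_count 4 k) = 620 * 2 ^ (2 * k) + 448260 * 2 ^ k + 15748000)
    \<and> (k \<ge> 6 \<longrightarrow> int (persym_count 5 k) =
          65100 * 2 ^ (2 * k) + 22654800 * 2 ^ k + 250817280)
    \<and> (k \<ge> 7 \<longrightarrow> int (persym_count 6 k) =
          1240 * (2 ^ (3 * k) + 3199 * 2 ^ (2 * k) + 2 ^ 7 * 3913 * 2 ^ k - 18883 * 2 ^ 10))
    \<and> (k \<ge> 8 \<longrightarrow> int (persym_count 7 k) =
          115320 * (2 ^ (3 * k) + 1148 * 2 ^ (2 * k) - 2 ^ 7 * 917 * 2 ^ k + 311 * 2 ^ 13))
    \<and> (k \<ge> 9 \<longrightarrow> int (persym_count 8 k) =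
          496 * (2 ^ (4 * k) + 9525 * 2 ^ (3 * k) - 2169440 * 2 ^ (2 * k)
                 + 68115 * 2 ^ 11 * 2 ^ k - 9749 * 2 ^ 18))
    \<and> (k \<ge> 10 \<longrightarrow> int (persym_count 9 k) =
          31248 * (2 ^ (4 * k) - 480 * 2 ^ (3 * k) + 71680 * 2 ^ (2 * k)
                   - 3932160 * 2 ^ k + 2 ^ 26))
    \<and> (k \<ge> 10 \<longrightarrow> int (persym_count 10 k) =
          2 ^ 5 * (2 ^ (5 * k) - 992 * 2 ^ (4 * k) + 317440 * 2 ^ (3 * k)
                   - 40632320 * 2 ^ (2 * k) + 2080374784 * 2 ^ k - 2 ^ 35))"
  \<comment> \<open>Over the reals, \<open>power_diff\<close> turns \<open>2 ^ (k - s)\<close> into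
    \<open>2 ^ k / 2 ^ s\<close>, so each claim becomes a polynomial identity in
    \<open>2 ^ k\<close>.\<close>
  by (intro conjI impI int_eqI)
    (simp_all add: persym_count_formula sum_atMost_numeral chain_count_32 chain_count_32_eq_0
      qbinomial_numeral qbinomial_eq_0 power_diff power_mult field_simps
      power2_eq_square power3_eq_cube power4_eq_xxxx power5_eq)

end
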